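(* Let $m,n\ge 1$ be integers, let $K\subset\mathbb{R}^n$ be a bounded star-shaped set with non-empty interior, let $\varepsilon\ge 0$, and let $A$ be an $m\times n$ random matrix with i.i.d. $N(0,1)$ entries. For each $x\in K$ let $$y=Ax+\nu,\qquad \frac1m\|\nu\|_1=\frac1m\sum_{i=1}^m|\nu_i|\le\varepsilon,$$ where the noise vector $\nu\in\mathbb{R}^m$ is otherwise arbitrary (in particular it may depend on $A$). Choose $\widehat{x}$ to be a solution to the program $$\text{minimize } \|x'\|_K\quad\text{subject to}\quad\frac1m\|Ax'-y\|_1\le\varepsilon .$$ Then $$\mathbb{E}\,\sup_{x\in K}\|\widehat{x}-x\|_2\le\sqrt{8\pi}\,\left(\frac{w(K)}{\sqrt m}+\varepsilon\right).$$
   Context: Star-shaped means $tK\subseteq K$ for all $t\in[0,1]$. The Minkowski functional of $K$ is $\|x\|_K=\inf\{\lambda>0:\lambda^{-1}x\in K\}$ for $x\in\mathbb{R}^n$. The Gaussian mean width of a bounded set $K\subset\mathbb{R}^n$ is $w(K)=\mathbb{E}\sup_{u\in K-K}\langle g,u\rangle$, where $g\sim N(0,I_n)$ and $K-K=\{u-v:u,v\in K\}$. The vector $\widehat{x}$ depends on $A$ and $y$. *)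

theory Defs
  imports "HOL-Probability.Probability"
begin

definition star_shaped :: "'a::real_vector set \<Rightarrow> bool" where
  "star_shaped K \<longleftrightarrow> (\<forall>t\<in>{0..1}. (\<lambda>x. t *\<^sub>R x) ` K \<subseteq> K)"

(* Extended-real valued: the infimum is over the empty set, hence \<infinity>, when no positive
   multiple of x lies in K. This can happen because 0 need not be an interior point of a
   star-shaped set with non-empty interior. *)
definition minkowski_functional :: "'a::real_vector set \<Rightarrow> 'a \<Rightarrow> ereal" where
  "minkowski_functional K x = (INF l\<in>{l::real. l > 0 \<and> inverse l *\<^sub>R x \<in> K}. ereal l)"

definition std_gaussian :: "(real ^ 'n) measure" where
  "std_gaussian = distr (\<Pi>\<^sub>M i\<in>(UNIV :: 'n set). density lborel std_normal_density) borel
     (\<lambda>f. \<chi> i. f i)"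

(* For bounded non-empty K the real supremum is a genuine one and the integrand is integrable. *)
definition gaussian_mean_width :: "(real ^ 'n) set \<Rightarrow> real" where
  "gaussian_mean_width K =
     (\<integral>g. (SUP u\<in>{u - v | u v. u \<in> K \<and> v \<in> K}. g \<bullet> u) \<partial>std_gaussian)"

definition norm1 :: "real ^ 'm \<Rightarrow> real" where
  "norm1 v = (\<Sum>i\<in>UNIV. \<bar>v $ i\<bar>)"

definition is_program_solution ::
  "(real ^ 'n) set \<Rightarrow> real \<Rightarrow> real ^ 'n ^ 'm \<Rightarrow> real ^ 'm \<Rightarrow> real ^ 'n \<Rightarrow> bool" where
  "is_program_solution K \<epsilon> A y =
     is_arg_min (minkowski_functional K) (\<lambda>x'. norm1 (A *v x' - y) / real CARD('m) \<le> \<epsilon>)"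

(* Expectation of a [0,\<infinity>]-valued function that need not be measurable (here the noise and the
   choice of minimiser are arbitrary, so the supremum need not be). The library's nn_integral
   is the lower integral on such functions, so bounding it would be weaker. The two agree on
   measurable functions, as shown below. *)
definition upper_expectation :: "'w measure \<Rightarrow> ('w \<Rightarrow> ennreal) \<Rightarrow> ennreal" where
  "upper_expectation M f =
     (INF h\<in>{h \<in> borel_measurable M. \<forall>\<omega>\<in>space M. f \<omega> \<le> h \<omega>}. \<integral>\<^sup>+\<omega>. h \<omega> \<partial>M)"

lemma upper_expectation_eq_nn_integral:
  assumes "f \<in> borel_measurable M"
  shows "upper_expectation M f = (\<integral>\<^sup>+\<omega>. f \<omega> \<partial>M)"
  unfolding upper_expectation_def
  by (rule antisym) (use assms in \<open>auto intro!: INF_lower INF_greatest nn_integral_mono\<close>)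

end

theory Submission
  imports Defs
begin

text \<open>
  Both \<open>x\<close> and \<open>xhat\<close> lie in the closure of \<open>K\<close> and are feasible, so \<open>z = xhat - x\<close> lies in the closure
  of \<open>K - K\<close> and satisfies \<open>norm1 (A z) \<le> 2 m \<epsilon>\<close>. As \<open>E\<bar>g \<bullet> z\<bar> = sqrt (2 / pi) * norm z\<close>, the error is
  controlled by the supremum over \<open>u \<in> K - K\<close> of \<open>m * sqrt (2 / pi) * norm u - norm1 (A u)\<close>.
  Rows are exchanged one at a time: conditionally on the other rows, replacing
  \<open>sqrt (2 / pi) * norm u - \<bar>a\<^sub>i \<bullet> u\<bar>\<close> by \<open>2 (a\<^sub>i \<bullet> u)\<close> does not decrease the expected supremum
  (symmetrization and contraction in one step). Since the sum of the rows has the law of \<open>sqrt m\<close> times a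
  standard Gaussian vector, the expected supremum is at most \<open>2 sqrt m * w(K)\<close>. All suprema are taken
  over a countable dense subset of \<open>K - K\<close>, which makes them measurable.
\<close>

subsection \<open>Standard Gaussian vectors\<close>

lemma borel_measurable_vec_lambda:
  fixes f :: "'j::finite \<Rightarrow> 'a \<Rightarrow> real"
  assumes "\<And>j. f j \<in> borel_measurable M"
  shows "(\<lambda>x. \<chi> j. f j x) \<in> borel_measurable M"
proof (subst borel_measurable_euclidean_space, rule ballI)
  fix b :: "real ^ 'j"
  assume "b \<in> Basis"
  then obtain j where "b = axis j 1"
    by (auto simp: Basis_vec_def)
  then show "(\<lambda>x. (\<chi> j. f j x) \<bullet> b) \<in> borel_measurable M"
    using assms[of j] by (simp add: inner_axis)
qed

lemma borel_measurable_vec_nth: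
  fixes f :: "'a \<Rightarrow> 'b::euclidean_space ^ 'j"
  assumes "f \<in> borel_measurable M"
  shows "(\<lambda>x. f x $ j) \<in> borel_measurable M"
  by (rule borel_measurable_continuous_on[OF linear_continuous_on[OF bounded_linear_vec_nth] assms])

lemma borel_measurable_vec_of_PiM [measurable]:
  assumes "\<And>i. sets (N i) = sets borel"
  shows "(\<lambda>f. \<chi> i. f i) \<in> PiM (UNIV :: 'j::finite set) N \<rightarrow>\<^sub>M (borel :: (real ^ 'j) measure)"
proof (rule borel_measurable_vec_lambda)
  show "(\<lambda>f. f i) \<in> borel_measurable (PiM UNIV N)" for i
    using measurable_component_singleton[of i UNIV N]
    unfolding measurable_cong_sets[OF refl assms] by simp
qed

lemma prob_space_std_normal: "prob_space (density lborel std_normal_density)"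
  by (rule prob_space_normal_density) simp

lemma sets_std_gaussian [measurable_cong, simp]: "sets std_gaussian = sets borel"
  by (simp add: std_gaussian_def)

lemma space_std_gaussian [simp]: "space std_gaussian = UNIV"
  by (simp add: std_gaussian_def)

lemma prob_space_std_gaussian: "prob_space (std_gaussian :: (real ^ 'n) measure)"
proof -
  interpret prob_space "\<Pi>\<^sub>M i\<in>(UNIV :: 'n set). density lborel std_normal_density"
    by (intro prob_space_PiM prob_space_std_normal)
  show ?thesis
    unfolding std_gaussian_def by (rule prob_space_distr, rule borel_measurable_vec_of_PiM) simp
qed

lemma distributed_lborel_distr:
  assumes "distributed M lborel X f"
  shows "distr M borel X = density lborel f"
  using distributed_distr_eq_density[OF assms] by (simp cong: distr_cong)

text \<open>Independence says that the joint law of the coordinates is the product of their laws,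
  and \<open>std_gaussian\<close> is that product carried over to vectors. This is how
  \<open>- g\<close> and the normalised sum of the matrix rows are recognised as standard
  Gaussian.\<close>

lemma (in prob_space) distr_indep_std_normal:
  fixes X :: "'n::finite \<Rightarrow> 'a \<Rightarrow> real"
  assumes X: "indep_vars (\<lambda>_. borel) X UNIV"
    and d: "\<And>j. distributed M lborel (X j) std_normal_density"
  shows "distr M borel (\<lambda>\<omega>. \<chi> j. X j \<omega>) = std_gaussian"
proof -
  have [measurable]: "X j \<in> borel_measurable M" for j
    using X by (auto simp: indep_vars_def)
  have "(\<Pi>\<^sub>M j\<in>(UNIV :: 'n set). density lborel std_normal_density) =
      distr M (\<Pi>\<^sub>M j\<in>UNIV. borel) (\<lambda>\<omega>. \<lambda>j\<in>UNIV. X j \<omega>)"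
    using X by (subst (asm) indep_vars_iff_distr_eq_PiM)
      (simp_all add: distributed_lborel_distr[OF d])
  then have "std_gaussian = distr (distr M (\<Pi>\<^sub>M j\<in>UNIV. borel) (\<lambda>\<omega>. \<lambda>j\<in>UNIV. X j \<omega>))
      borel (\<lambda>f. \<chi> j. f j)"
    by (simp add: std_gaussian_def)
  also have "\<dots> = distr M borel (\<lambda>\<omega>. \<chi> j. X j \<omega>)"
    by (subst distr_distr) (auto simp: comp_def restrict_UNIV intro: measurable_PiM_single')
  finally show ?thesis ..
qed

lemma distr_std_gaussian_nth:
  "distr (std_gaussian :: (real ^ 'n) measure) borel (\<lambda>g. g $ j) = density lborel std_normal_density"
proof -
  have "distr (std_gaussian :: (real ^ 'n) measure) borel (\<lambda>g. g $ j) =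
      distr (\<Pi>\<^sub>M i\<in>(UNIV :: 'n set). density lborel std_normal_density)
        (density lborel std_normal_density) (\<lambda>f. f j)"
    unfolding std_gaussian_def by (subst distr_distr) (auto simp: comp_def cong: distr_cong)
  also have "\<dots> = density lborel std_normal_density"
    by (rule distr_PiM_component) (auto intro: prob_space_std_normal)
  finally show ?thesis .
qed

lemma distributed_std_gaussian_nth:
  "distributed (std_gaussian :: (real ^ 'n) measure) lborel (\<lambda>g. g $ j) std_normal_density"
proof -
  have "distr (std_gaussian :: (real ^ 'n) measure) lborel (\<lambda>g. g $ j) =
      distr (std_gaussian :: (real ^ 'n) measure) borel (\<lambda>g. g $ j)"
    by (rule distr_cong) simp_all
  then show ?thesis
    unfolding distributed_def distr_std_gaussian_nth by simp
qed

text \<open>Packing a function into a vector and reading off its coordinates cancel, so the joint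
  law of the coordinates is the original product measure.\<close>

lemma indep_vars_std_gaussian_nth:
  "prob_space.indep_vars (std_gaussian :: (real ^ 'n) measure) (\<lambda>_. borel) (\<lambda>j g. g $ j) UNIV"
proof -
  interpret prob_space "std_gaussian :: (real ^ 'n) measure"
    by (rule prob_space_std_gaussian)
  have "distr (std_gaussian :: (real ^ 'n) measure) (\<Pi>\<^sub>M j\<in>UNIV. borel) (\<lambda>g. \<lambda>j\<in>UNIV. g $ j) =
      distr (\<Pi>\<^sub>M i\<in>(UNIV :: 'n set). density lborel std_normal_density) (\<Pi>\<^sub>M j\<in>UNIV. borel) (\<lambda>f. f)"
    unfolding std_gaussian_def
  proof (subst distr_distr)
    show "(\<lambda>g. \<lambda>j\<in>UNIV. g $ j) \<in> (borel :: (real ^ 'n) measure) \<rightarrow>\<^sub>M (\<Pi>\<^sub>M j\<in>UNIV. borel)"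
      by (intro measurable_restrict borel_measurable_vec_nth) simp
  qed (auto simp: comp_def restrict_UNIV vec_lambda_inverse)
  also have "\<dots> = (\<Pi>\<^sub>M i\<in>(UNIV :: 'n set). density lborel std_normal_density)"
    by (rule distr_id2) (auto intro!: sets_PiM_cong)
  finally show ?thesis
    by (subst indep_vars_iff_distr_eq_PiM) (simp_all add: distr_std_gaussian_nth)
qed

lemma distr_std_gaussian_uminus: "distr std_gaussian borel uminus = (std_gaussian :: (real ^ 'n) measure)"
proof -
  interpret prob_space "std_gaussian :: (real ^ 'n) measure"
    by (rule prob_space_std_gaussian)
  have "distr std_gaussian borel (\<lambda>g::real^'n. \<chi> j. - (g $ j)) = std_gaussian"
  proof (rule distr_indep_std_normal)
    show "indep_vars (\<lambda>_. borel) (\<lambda>j (g::real^'n). - (g $ j)) UNIV"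
      by (rule indep_vars_compose2[OF indep_vars_std_gaussian_nth]) simp
    show "distributed std_gaussian lborel (\<lambda>g::real^'n. - (g $ j)) std_normal_density" for j
      using normal_density_affine[OF distributed_std_gaussian_nth, of "-1" 0] by simp
  qed
  also have "(\<lambda>g::real^'n. \<chi> j. - (g $ j)) = uminus"
    by (auto simp: vec_eq_iff)
  finally show ?thesis .
qed

lemma distributed_std_gaussian_inner:
  fixes u :: "real ^ 'n"
  assumes "u \<noteq> 0"
  shows "distributed std_gaussian lborel (\<lambda>g. g \<bullet> u) (normal_density 0 (norm u))"
proof -
  interpret prob_space "std_gaussian :: (real ^ 'n) measure"
    by (rule prob_space_std_gaussian)
  \<comment> \<open>Coordinates with coefficient 0 are left out because
    \<open>sum_indep_normal\<close> needs positive standard deviations; \<open>u \<noteq> 0\<close>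
    keeps the index set non-empty.\<close>
  let ?J = "{j. u $ j \<noteq> 0}"
  have "distributed std_gaussian lborel (\<lambda>g. \<Sum>j\<in>?J. u $ j * g $ j)
      (normal_density (\<Sum>j\<in>?J. 0) (sqrt (\<Sum>j\<in>?J. \<bar>u $ j\<bar>\<^sup>2)))"
  proof (rule sum_indep_normal)
    show "?J \<noteq> {}"
      using assms by (auto simp: vec_eq_iff)
    show "indep_vars (\<lambda>_. borel) (\<lambda>j (g::real^'n). u $ j * g $ j) ?J"
      by (rule indep_vars_subset[OF indep_vars_compose2[OF indep_vars_std_gaussian_nth]]) auto
    show "distributed std_gaussian lborel (\<lambda>g::real^'n. u $ j * g $ j) (normal_density 0 \<bar>u $ j\<bar>)"
      if "j \<in> ?J" for j
      using normal_density_affine[OF distributed_std_gaussian_nth, of "u $ j" 0 j] that by simp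
  qed auto
  moreover have "(\<Sum>j\<in>?J. u $ j * g $ j) = g \<bullet> u" for g
    unfolding inner_vec_def by (rule sum.mono_neutral_cong_left) auto
  moreover have "(\<Sum>j\<in>?J. \<bar>u $ j\<bar>\<^sup>2) = (\<Sum>j\<in>UNIV. (u $ j)\<^sup>2)"
    by (rule sum.mono_neutral_cong_left) auto
  ultimately show ?thesis
    by (simp add: norm_vec_def L2_set_def)
qed

lemma nn_integral_abs_inner_std_gaussian:
  fixes u :: "real ^ 'n"
  shows "(\<integral>\<^sup>+g. ennreal \<bar>g \<bullet> u\<bar> \<partial>std_gaussian) = ennreal (sqrt (2 / pi) * norm u)"
proof (cases "u = 0")
  case False
  have "(\<integral>\<^sup>+g. ennreal \<bar>g \<bullet> u\<bar> \<partial>std_gaussian) =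
      (\<integral>\<^sup>+x. normal_density 0 (norm u) x * ennreal \<bar>x\<bar> \<partial>lborel)"
    by (rule distributed_nn_integral[OF distributed_std_gaussian_inner[OF False], symmetric]) simp
  \<comment> \<open>The integrand is put in the shape of the absolute moment of order
    \<open>2 * k + 1\<close> with \<open>k = 0\<close>; this moment is the source of the constant
    \<open>sqrt (2 / pi)\<close>.\<close>
  also have "\<dots> = (\<integral>\<^sup>+x. ennreal (normal_density 0 (norm u) x * \<bar>x - 0\<bar> ^ (2 * 0 + 1)) \<partial>lborel)"
    by (simp add: ennreal_mult')
  also have "\<dots> = ennreal (2 ^ 0 * norm u ^ (2 * 0 + 1) * fact 0 * sqrt (2 / pi))"
    using normal_moment_abs_odd[of "norm u" 0 0] False
    by (intro nn_integral_eq_integral[THEN trans])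
      (auto simp: has_bochner_integral_iff mult_ac)
  finally show ?thesis
    by (simp add: mult.commute)
qed simp

text \<open>The norm is at most the sum of the \<open>\<bar>g $ j\<bar>\<close>, each integrable as
  the inner product with a unit vector. It serves as majorant for the integrand of the mean
  width.\<close>

lemma integrable_norm_std_gaussian: "integrable (std_gaussian :: (real ^ 'n) measure) norm"
proof (rule Bochner_Integration.integrable_bound)
  have "integrable (std_gaussian :: (real ^ 'n) measure) (\<lambda>g. \<bar>g $ j\<bar>)" for j
    using nn_integral_abs_inner_std_gaussian[of "axis j 1 :: real^'n"]
    by (intro integrableI_bounded) (auto simp: inner_axis)
  then show "integrable (std_gaussian :: (real ^ 'n) measure) (\<lambda>g. \<Sum>j\<in>UNIV. \<bar>g $ j\<bar>)"
    by simp
  show "AE g in (std_gaussian :: (real ^ 'n) measure). norm (norm g) \<le> norm (\<Sum>j\<in>UNIV. \<bar>g $ j\<bar>)"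
    using norm_le_l1_cart by (auto intro: order_trans)
qed simp

subsection \<open>Symmetrization and contraction\<close>

lemma bdd_above_image_add:
  fixes f g :: "'a \<Rightarrow> real"
  assumes "bdd_above (f ` D)" "bdd_above (g ` D)"
  shows "bdd_above ((\<lambda>u. f u + g u) ` D)"
proof -
  obtain a b where "\<And>u. u \<in> D \<Longrightarrow> f u \<le> a" "\<And>u. u \<in> D \<Longrightarrow> g u \<le> b"
    using assms by (auto simp: bdd_above_def)
  then show ?thesis
    by (intro bdd_aboveI2[of _ _ "a + b"] add_mono)
qed

lemma bounded_imp_bdd_above_image_of_le_norm:
  fixes D :: "'a::real_normed_vector set" and f :: "'a \<Rightarrow> real"
  assumes "bounded D" "\<And>u. f u \<le> B * norm u" "B \<ge> 0"
  shows "bdd_above (f ` D)"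
proof -
  obtain R where R: "\<And>u. u \<in> D \<Longrightarrow> norm u \<le> R"
    using assms(1) by (auto simp: bounded_iff)
  show ?thesis
  proof (rule bdd_aboveI2)
    fix u assume "u \<in> D"
    have "f u \<le> B * norm u" by fact
    also have "\<dots> \<le> B * R"
      using R[OF \<open>u \<in> D\<close>] assms(3) by (rule mult_left_mono)
    finally show "f u \<le> B * R" .
  qed
qed

text \<open>Taking the supremum over \<open>u\<close> with \<open>v\<close> fixed and then over
  \<open>v\<close> suffices. The two points vary independently, which the contraction step
  requires.\<close>

lemma cSUP_add_le:
  fixes f g :: "'a \<Rightarrow> real"
  assumes "D \<noteq> {}" "\<And>u v. u \<in> D \<Longrightarrow> v \<in> D \<Longrightarrow> f u + g v \<le> C"
  shows "(SUP u\<in>D. f u) + (SUP u\<in>D. g u) \<le> C"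
proof -
  have "(SUP u\<in>D. f u) \<le> C - g v" if "v \<in> D" for v
    using assms that by (intro cSUP_least) (auto simp: le_diff_eq)
  then have "(SUP v\<in>D. g v) \<le> C - (SUP u\<in>D. f u)"
    using assms(1) by (intro cSUP_least) (auto simp: le_diff_eq add.commute)
  then show ?thesis by simp
qed

lemma bdd_above_inner:
  fixes D :: "'a::real_inner set"
  assumes "bounded D"
  shows "bdd_above ((\<lambda>u. a * (q \<bullet> u)) ` D)"
proof (rule bounded_imp_bdd_above_image_of_le_norm[OF assms])
  fix u
  have "a * (q \<bullet> u) \<le> \<bar>a\<bar> * \<bar>q \<bullet> u\<bar>"
    by (metis abs_ge_self abs_mult)
  also have "\<dots> \<le> \<bar>a\<bar> * (norm q * norm u)"
    by (intro mult_left_mono Cauchy_Schwarz_ineq2) simp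
  finally show "a * (q \<bullet> u) \<le> \<bar>a\<bar> * norm q * norm u" by (simp add: mult.assoc)
qed simp

lemma bdd_above_abs_inner:
  fixes D :: "'a::real_inner set"
  assumes "bounded D"
  shows "bdd_above ((\<lambda>u. a * \<bar>q \<bullet> u\<bar>) ` D)"
proof (rule bounded_imp_bdd_above_image_of_le_norm[OF assms])
  fix u
  have "a * \<bar>q \<bullet> u\<bar> \<le> \<bar>a\<bar> * \<bar>q \<bullet> u\<bar>"
    by (intro mult_right_mono) auto
  also have "\<dots> \<le> \<bar>a\<bar> * (norm q * norm u)"
    by (intro mult_left_mono Cauchy_Schwarz_ineq2) simp
  finally show "a * \<bar>q \<bullet> u\<bar> \<le> \<bar>a\<bar> * norm q * norm u" by (simp add: mult.assoc)
qed simp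

lemma bdd_above_norm_mult:
  fixes D :: "'a::real_normed_vector set"
  assumes "bounded D" "a \<ge> 0"
  shows "bdd_above ((\<lambda>u. a * norm u) ` D)"
  by (rule bounded_imp_bdd_above_image_of_le_norm[OF assms(1), of _ a]) (use assms in auto)

lemma cSUP_nonneg:
  fixes f :: "'a::zero \<Rightarrow> real"
  assumes "bdd_above (f ` D)" "0 \<in> D" "0 \<le> f 0"
  shows "0 \<le> (SUP u\<in>D. f u)"
  using cSUP_upper[OF assms(2,1)] assms(3) by simp

section \<open>Exchanging one Gaussian row\<close>

lemma nn_integral_std_gaussian_uminus:
  assumes "f \<in> borel_measurable (borel :: (real ^ 'n) measure)"
  shows "(\<integral>\<^sup>+g. f (- g) \<partial>std_gaussian) = (\<integral>\<^sup>+g. f g \<partial>(std_gaussian :: (real ^ 'n) measure))"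
proof -
  have "(\<integral>\<^sup>+g. f g \<partial>std_gaussian) = (\<integral>\<^sup>+g. f g \<partial>distr std_gaussian borel uminus)"
    by (simp only: distr_std_gaussian_uminus)
  also have "\<dots> = (\<integral>\<^sup>+g. f (- g) \<partial>std_gaussian)"
    using assms by (intro nn_integral_distr) auto
  finally show ?thesis ..
qed

text \<open>
  Write the left-hand supremum as at most the average of the suprema of \<open>G u + 2 E\<bar>g \<bullet> u\<bar>\<close> and
  \<open>G u - 2 \<bar>g \<bullet> u\<bar>\<close>. After Jensen, the sum of two suprema with opposite signs is controlled by
  \<open>\<bar>g \<bullet> u\<bar> - \<bar>g \<bullet> v\<bar> \<le> \<bar>g \<bullet> u - g \<bullet> v\<bar>\<close>, and the symmetry of the Gaussian measure replaces random signs.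
\<close>

lemma nn_integral_sup_gaussian_row:
  fixes D :: "(real ^ 'n) set" and G :: "real ^ 'n \<Rightarrow> real"
  assumes "countable D" "bounded D" "0 \<in> D" "bdd_above (G ` D)" "0 \<le> G 0"
  shows "(\<integral>\<^sup>+g. ennreal (SUP u\<in>D. G u + (sqrt (2 / pi) * norm u - \<bar>g \<bullet> u\<bar>)) \<partial>std_gaussian)
    \<le> (\<integral>\<^sup>+g. ennreal (SUP u\<in>D. G u + 2 * (g \<bullet> u)) \<partial>std_gaussian)"
proof -
  interpret prob_space "std_gaussian :: (real ^ 'n) measure"
    by (rule prob_space_std_gaussian)
  let ?c = "sqrt (2 / pi)"
  define P where "P g = (SUP u\<in>D. G u + 2 * \<bar>g \<bullet> u\<bar>)" for g
  define N where "N g = (SUP u\<in>D. G u - 2 * \<bar>g \<bullet> u\<bar>)" for g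
  define L where "L g = (SUP u\<in>D. G u + 2 * (g \<bullet> u))" for g
  define C where "C = (SUP u\<in>D. G u + 2 * ?c * norm u)"
  have bP: "bdd_above ((\<lambda>u. G u + 2 * \<bar>g \<bullet> u\<bar>) ` D)" for g
    using assms by (intro bdd_above_image_add bdd_above_abs_inner)
  have bN: "bdd_above ((\<lambda>u. G u - 2 * \<bar>g \<bullet> u\<bar>) ` D)" for g
    using bdd_above_image_add[OF assms(4) bdd_above_abs_inner[OF assms(2), of "-2"]] by simp
  have bL: "bdd_above ((\<lambda>u. G u + 2 * (g \<bullet> u)) ` D)" for g
    using assms by (intro bdd_above_image_add bdd_above_inner)
  have bC: "bdd_above ((\<lambda>u. G u + 2 * ?c * norm u) ` D)"
    using assms by (intro bdd_above_image_add bdd_above_norm_mult) auto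
  have [measurable]: "P \<in> borel_measurable borel" "N \<in> borel_measurable borel"
    "L \<in> borel_measurable borel"
    unfolding P_def N_def L_def using assms(1) bP bN bL by (auto intro!: borel_measurable_cSUP)
  \<comment> \<open>The point \<open>0 \<in> D\<close> with \<open>0 \<le> G 0\<close> makes these
    suprema nonnegative, so \<open>ennreal\<close> truncates none of them and turns their sums into
    sums of integrals.\<close>
  have P0: "0 \<le> P g" and N0: "0 \<le> N g" and L0: "0 \<le> L g" for g
    unfolding P_def N_def L_def using assms(3,5) bP bN bL by (auto intro!: cSUP_nonneg)
  have C0: "0 \<le> C"
    unfolding C_def using assms(3,5) bC by (auto intro!: cSUP_nonneg)

  \<comment> \<open>Jensen: \<open>?c * norm u\<close> is the mean of \<open>\<bar>g \<bullet> u\<bar>\<close>.\<close>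
  have CP: "ennreal C \<le> (\<integral>\<^sup>+g. ennreal (P g) \<partial>std_gaussian)"
  proof (cases "(\<integral>\<^sup>+g. ennreal (P g) \<partial>std_gaussian) = \<infinity>")
    case False
    then have iP: "integrable std_gaussian P"
      by (intro integrableI_nonneg) (auto simp: P0 less_top)
    have "C \<le> (\<integral>g. P g \<partial>std_gaussian)"
      unfolding C_def
    proof (rule cSUP_least)
      fix u assume u: "u \<in> D"
      have "has_bochner_integral std_gaussian (\<lambda>g. \<bar>g \<bullet> u\<bar>) (?c * norm u)"
        by (rule has_bochner_integral_nn_integral) (auto simp: nn_integral_abs_inner_std_gaussian)
      then have "G u + 2 * (?c * norm u) = (\<integral>g. G u + 2 * \<bar>g \<bullet> u\<bar> \<partial>std_gaussian)"
        and "integrable std_gaussian (\<lambda>g. G u + 2 * \<bar>g \<bullet> u\<bar>)"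
        by (auto simp: has_bochner_integral_iff prob_space[simplified])
      moreover have "G u + 2 * \<bar>g \<bullet> u\<bar> \<le> P g" for g
        unfolding P_def by (rule cSUP_upper[OF u bP])
      ultimately show "G u + 2 * ?c * norm u \<le> (\<integral>g. P g \<partial>std_gaussian)"
        using iP by (simp add: mult.assoc) (rule integral_mono, auto)
    qed (use assms in auto)
    then show ?thesis
      using iP by (simp add: nn_integral_eq_integral P0 ennreal_leI)
  qed simp

  have split: "2 * (SUP u\<in>D. G u + (?c * norm u - \<bar>g \<bullet> u\<bar>)) \<le> C + N g" for g
  proof -
    have "(SUP u\<in>D. G u + (?c * norm u - \<bar>g \<bullet> u\<bar>)) \<le> (C + N g) / 2"
    proof (rule cSUP_least)
      fix u assume u: "u \<in> D"
      show "G u + (?c * norm u - \<bar>g \<bullet> u\<bar>) \<le> (C + N g) / 2"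
        unfolding C_def N_def using cSUP_upper[OF u bC] cSUP_upper[OF u bN[of g]] by simp
    qed (use assms in auto)
    then show ?thesis by simp
  qed

  have contr: "P g + N g \<le> L g + L (- g)" for g
    unfolding P_def N_def
  proof (rule cSUP_add_le)
    fix u v assume u: "u \<in> D" and v: "v \<in> D"
    \<comment> \<open>If \<open>g \<bullet> u\<close> is nonnegative, \<open>u\<close> is charged to
      \<open>L g\<close>, otherwise to \<open>L (- g)\<close>. The other summand absorbs
      \<open>v\<close>, because \<open>- \<bar>g \<bullet> v\<bar>\<close> lies below both
      \<open>g \<bullet> v\<close> and its negative.\<close>
    have "G u + 2 * (g \<bullet> u) \<le> L g" "G v + 2 * (g \<bullet> v) \<le> L g"
      "G u + 2 * (- g \<bullet> u) \<le> L (- g)" "G v + 2 * (- g \<bullet> v) \<le> L (- g)"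
      unfolding L_def by (rule cSUP_upper[OF _ bL]; fact)+
    then show "G u + 2 * \<bar>g \<bullet> u\<bar> + (G v - 2 * \<bar>g \<bullet> v\<bar>) \<le> L g + L (- g)"
      by (simp add: abs_if split: if_splits)
  qed (use assms in auto)

  have "2 * (\<integral>\<^sup>+g. ennreal (SUP u\<in>D. G u + (?c * norm u - \<bar>g \<bullet> u\<bar>)) \<partial>std_gaussian) \<le>
      (\<integral>\<^sup>+g. ennreal C + ennreal (N g) \<partial>std_gaussian)"
  proof (subst nn_integral_cmult[symmetric])
    show "(\<lambda>g. ennreal (SUP u\<in>D. G u + (?c * norm u - \<bar>g \<bullet> u\<bar>))) \<in> borel_measurable std_gaussian"
    proof (intro measurable_compose[OF _ measurable_ennreal] borel_measurable_cSUP assms(1))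
      fix g :: "real ^ 'n"
      show "bdd_above ((\<lambda>u. G u + (?c * norm u - \<bar>g \<bullet> u\<bar>)) ` D)"
        using bdd_above_image_add[OF assms(4) bdd_above_image_add[OF
          bdd_above_norm_mult[OF assms(2), of ?c] bdd_above_abs_inner[OF assms(2), of "-1" g]]]
        by simp
    qed simp
    show "(\<integral>\<^sup>+g. 2 * ennreal (SUP u\<in>D. G u + (?c * norm u - \<bar>g \<bullet> u\<bar>)) \<partial>std_gaussian)
      \<le> (\<integral>\<^sup>+g. ennreal C + ennreal (N g) \<partial>std_gaussian)"
    proof (rule nn_integral_mono)
      fix g :: "real ^ 'n"
      have "2 * ennreal (SUP u\<in>D. G u + (?c * norm u - \<bar>g \<bullet> u\<bar>)) =
          ennreal (2 * (SUP u\<in>D. G u + (?c * norm u - \<bar>g \<bullet> u\<bar>)))"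
        by (simp add: ennreal_mult')
      also have "\<dots> \<le> ennreal (C + N g)"
        by (rule ennreal_leI[OF split])
      finally show "2 * ennreal (SUP u\<in>D. G u + (?c * norm u - \<bar>g \<bullet> u\<bar>)) \<le> ennreal C + ennreal (N g)"
        by (simp add: C0 N0)
    qed
  qed
  also have "\<dots> = ennreal C + (\<integral>\<^sup>+g. ennreal (N g) \<partial>std_gaussian)"
    by (subst nn_integral_add) (auto simp: emeasure_space_1[simplified])
  also have "\<dots> \<le> (\<integral>\<^sup>+g. ennreal (P g) \<partial>std_gaussian) + (\<integral>\<^sup>+g. ennreal (N g) \<partial>std_gaussian)"
    by (rule add_right_mono[OF CP])
  also have "\<dots> = (\<integral>\<^sup>+g. ennreal (P g + N g) \<partial>std_gaussian)"
    by (simp add: nn_integral_add P0 N0)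
  also have "\<dots> \<le> (\<integral>\<^sup>+g. ennreal (L g + L (- g)) \<partial>std_gaussian)"
    by (intro nn_integral_mono ennreal_leI contr)
  also have "\<dots> = (\<integral>\<^sup>+g. ennreal (L g) \<partial>std_gaussian) + (\<integral>\<^sup>+g. ennreal (L (- g)) \<partial>std_gaussian)"
    by (simp add: nn_integral_add L0)
  also have "\<dots> = 2 * (\<integral>\<^sup>+g. ennreal (L g) \<partial>std_gaussian)"
    by (subst nn_integral_std_gaussian_uminus) (simp_all add: mult_2)
  finally show ?thesis
    unfolding L_def by (simp add: ennreal_mult_le_mult_iff)
qed

section \<open>Exchanging all rows\<close>

lemma bdd_above_image_sum:
  fixes f :: "'i \<Rightarrow> 'a \<Rightarrow> real"
  assumes "\<And>i. i \<in> I \<Longrightarrow> bdd_above (f i ` D)"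
  shows "bdd_above ((\<lambda>u. \<Sum>i\<in>I. f i u) ` D)"
  using assms
proof (induction I rule: infinite_finite_induct)
  case (insert i I)
  then show ?case
    using bdd_above_image_add[of "f i" D "\<lambda>u. \<Sum>i\<in>I. f i u"] by simp
qed (auto intro: bdd_aboveI2)

text \<open>Induction on the rows with \<open>G\<close> arbitrary: \<open>G\<close> collects
  whatever is held fixed. Row \<open>i\<close> is exchanged first, given the rows in
  \<open>I\<close>; then the rows in \<open>I\<close> are exchanged by the induction hypothesis,
  given row \<open>i\<close>.\<close>

lemma nn_integral_sup_gaussian_rows:
  fixes D :: "(real ^ 'n) set" and G :: "real ^ 'n \<Rightarrow> real"
  assumes "finite I" "countable D" "bounded D" "0 \<in> D" "bdd_above (G ` D)" "0 \<le> G 0"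
  shows "(\<integral>\<^sup>+x. ennreal (SUP u\<in>D. G u + (\<Sum>i\<in>I. sqrt (2 / pi) * norm u - \<bar>x i \<bullet> u\<bar>))
      \<partial>(\<Pi>\<^sub>M i\<in>I. std_gaussian))
    \<le> (\<integral>\<^sup>+x. ennreal (SUP u\<in>D. G u + (\<Sum>i\<in>I. 2 * (x i \<bullet> u))) \<partial>(\<Pi>\<^sub>M i\<in>I. std_gaussian))"
  using assms(1,5,6)
proof (induction I arbitrary: G rule: finite_induct)
  case (insert i I)
  interpret product_sigma_finite "\<lambda>_. std_gaussian :: (real ^ 'n) measure"
    by (rule product_sigma_finite.intro)
      (rule prob_space_imp_sigma_finite[OF prob_space_std_gaussian])
  define h where "h y u = sqrt (2 / pi) * norm u - \<bar>y \<bullet> u\<bar>" for y u :: "real ^ 'n"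
  let ?PI = "\<Pi>\<^sub>M i\<in>I. (std_gaussian :: (real ^ 'n) measure)"
  let ?PJ = "\<Pi>\<^sub>M i\<in>insert i I. (std_gaussian :: (real ^ 'n) measure)"
  have bh: "bdd_above ((\<lambda>u. h y u) ` D)" for y
    unfolding h_def
    using bdd_above_image_add[OF bdd_above_norm_mult[OF assms(3), of "sqrt (2 / pi)"]
      bdd_above_abs_inner[OF assms(3), of "-1" y]] by simp
  note bI = insert.prems(1) bdd_above_image_sum bdd_above_image_add bh bdd_above_inner[OF assms(3)]
  have hm [measurable]: "(\<lambda>x. h (x j) u) \<in> borel_measurable (\<Pi>\<^sub>M i\<in>J. (std_gaussian :: (real ^ 'n) measure))"
    if "j \<in> J" for j u and J :: "'a set"
    unfolding h_def using that by measurable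
  \<comment> \<open>Splitting off coordinate \<open>i\<close> evaluates the integrand at
    \<open>x(i := y)\<close>; as \<open>i\<close> is not in \<open>I\<close>, sums over
    \<open>I\<close> do not see the update.\<close>
  have eq: "(\<Sum>j\<in>I. k (if j = i then y else x j) u) = (\<Sum>j\<in>I. k (x j) u)"
    for x and y u :: "real ^ 'n" and k :: "real ^ 'n \<Rightarrow> real ^ 'n \<Rightarrow> real"
    using insert.hyps by (intro sum.cong) auto

  have "(\<integral>\<^sup>+x. ennreal (SUP u\<in>D. G u + (\<Sum>i\<in>insert i I. h (x i) u)) \<partial>?PJ) =
      (\<integral>\<^sup>+x. \<integral>\<^sup>+y. ennreal (SUP u\<in>D. (G u + (\<Sum>i\<in>I. h (x i) u)) + h y u) \<partial>std_gaussian \<partial>?PI)"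
  proof (subst product_nn_integral_insert)
    show "(\<lambda>x. ennreal (SUP u\<in>D. G u + (\<Sum>i\<in>insert i I. h (x i) u))) \<in> borel_measurable ?PJ"
      by (intro measurable_compose[OF _ measurable_ennreal] borel_measurable_cSUP assms bI) measurable
  qed (use insert.hyps in \<open>simp_all add: eq[of "h"] add_ac\<close>)
  \<comment> \<open>For fixed \<open>x\<close> the terms of the rows in \<open>I\<close> belong to
    the shift; it is still nonnegative at 0 since \<open>h\<close> vanishes there.\<close>
  also have "\<dots> \<le> (\<integral>\<^sup>+x. \<integral>\<^sup>+y. ennreal (SUP u\<in>D. (G u + (\<Sum>i\<in>I. h (x i) u)) + 2 * (y \<bullet> u)) \<partial>std_gaussian \<partial>?PI)"
    using insert.prems unfolding h_def[of y for y]
    by (intro nn_integral_mono nn_integral_sup_gaussian_row assms bI[unfolded h_def]) (auto simp: h_def)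
  also have "\<dots> = (\<integral>\<^sup>+x. ennreal (SUP u\<in>D. (G u + (\<Sum>i\<in>I. h (x i) u)) + 2 * (x i \<bullet> u)) \<partial>?PJ)"
  proof (subst product_nn_integral_insert)
    show "(\<lambda>x. ennreal (SUP u\<in>D. (G u + (\<Sum>i\<in>I. h (x i) u)) + 2 * (x i \<bullet> u))) \<in> borel_measurable ?PJ"
      by (intro measurable_compose[OF _ measurable_ennreal] borel_measurable_cSUP assms bI) measurable
  qed (use insert.hyps in \<open>simp_all add: eq[of "h"]\<close>)
  \<comment> \<open>Reversing the order of integration puts row \<open>i\<close> outside, so that
    \<open>G u + 2 * (y \<bullet> u)\<close> is a fixed shift for the induction hypothesis.\<close>
  also have "\<dots> = (\<integral>\<^sup>+y. \<integral>\<^sup>+x. ennreal (SUP u\<in>D. (G u + 2 * (y \<bullet> u)) + (\<Sum>i\<in>I. h (x i) u)) \<partial>?PI \<partial>std_gaussian)"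
  proof (subst product_nn_integral_insert_rev)
    show "(\<lambda>x. ennreal (SUP u\<in>D. (G u + (\<Sum>i\<in>I. h (x i) u)) + 2 * (x i \<bullet> u))) \<in> borel_measurable ?PJ"
      by (intro measurable_compose[OF _ measurable_ennreal] borel_measurable_cSUP assms bI) measurable
  qed (use insert.hyps in \<open>simp_all add: eq[of "h"] add_ac\<close>)
  also have "\<dots> \<le> (\<integral>\<^sup>+y. \<integral>\<^sup>+x. ennreal (SUP u\<in>D. (G u + 2 * (y \<bullet> u)) + (\<Sum>i\<in>I. 2 * (x i \<bullet> u))) \<partial>?PI \<partial>std_gaussian)"
    using insert.prems unfolding h_def
    by (intro nn_integral_mono insert.IH bI) auto
  also have "\<dots> = (\<integral>\<^sup>+x. ennreal (SUP u\<in>D. G u + (\<Sum>i\<in>insert i I. 2 * (x i \<bullet> u))) \<partial>?PJ)"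
  proof (subst product_nn_integral_insert_rev)
    show "(\<lambda>x. ennreal (SUP u\<in>D. G u + (\<Sum>i\<in>insert i I. 2 * (x i \<bullet> u)))) \<in> borel_measurable ?PJ"
      by (intro measurable_compose[OF _ measurable_ennreal] borel_measurable_cSUP assms bI) measurable
  qed (use insert.hyps in \<open>simp_all add: eq[of "\<lambda>y u. 2 * (y \<bullet> u)"] add_ac\<close>)
  finally show ?case
    unfolding h_def .
qed simp

subsection \<open>Gaussian matrices\<close>

lemma (in prob_space) indep_vars_reindex_UNIV:
  assumes "indep_vars (\<lambda>_. N) X UNIV" "inj f"
  shows "indep_vars (\<lambda>_. N) (\<lambda>i. X (f i)) UNIV"
proof -
  \<comment> \<open>Injectivity makes the singleton blocks \<open>{f i}\<close> disjoint; evaluating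
    each block at its only index gives the reindexed family.\<close>
  have "indep_vars (\<lambda>i. PiM {f i} (\<lambda>_. N)) (\<lambda>i \<omega>. restrict (\<lambda>k. X k \<omega>) {f i}) UNIV"
    using assms(2) by (intro indep_vars_restrict[OF assms(1)]) (auto simp: disjoint_family_on_def inj_def)
  from indep_vars_compose2[OF this, of "\<lambda>i y. y (f i)" "\<lambda>_. N"] show ?thesis
    by simp
qed

context prob_space
begin

context
  fixes A :: "'a \<Rightarrow> real ^ 'n ^ 'm"
  assumes ind: "indep_vars (\<lambda>_. borel) (\<lambda>(i, j) \<omega>. A \<omega> $ i $ j) (UNIV :: ('m \<times> 'n) set)"
    and dist: "\<And>i j. distributed M lborel (\<lambda>\<omega>. A \<omega> $ i $ j) std_normal_density"
begin

lemma random_variable_gaussian_row: "random_variable borel (\<lambda>\<omega>. A \<omega> $ i)"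
proof -
  have "random_variable borel (\<lambda>\<omega>. A \<omega> $ i $ j)" for j
    using dist[of i j] by (simp add: distributed_def)
  from borel_measurable_vec_lambda[of "\<lambda>j \<omega>. A \<omega> $ i $ j", OF this] show ?thesis
    by simp
qed

lemma distr_gaussian_row: "distr M borel (\<lambda>\<omega>. A \<omega> $ i) = std_gaussian"
proof -
  have "indep_vars (\<lambda>_. borel) (\<lambda>j \<omega>. A \<omega> $ i $ j) UNIV"
    using indep_vars_reindex_UNIV[OF ind, of "Pair i"] by (simp add: inj_def)
  from distr_indep_std_normal[OF this dist] show ?thesis
    by simp
qed

text \<open>Grouping the entries into the disjoint blocks \<open>{i} \<times> UNIV\<close> makes the
  rows independent, and each row is standard Gaussian.\<close>

lemma distr_gaussian_rows:
  "distr M (\<Pi>\<^sub>M i\<in>UNIV. borel) (\<lambda>\<omega>. \<lambda>i\<in>UNIV. A \<omega> $ i) = (\<Pi>\<^sub>M i\<in>UNIV. std_gaussian)"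
proof -
  let ?K = "\<lambda>i. {i} \<times> (UNIV :: 'n set)"
  have "indep_vars (\<lambda>i. PiM (?K i) (\<lambda>_. borel))
      (\<lambda>i \<omega>. restrict (\<lambda>k. (case k of (i, j) \<Rightarrow> \<lambda>\<omega>. A \<omega> $ i $ j) \<omega>) (?K i)) UNIV"
    by (intro indep_vars_restrict[OF ind]) (auto simp: disjoint_family_on_def)
  from indep_vars_compose2[OF this, of "\<lambda>i y. \<chi> j. y (i, j)" "\<lambda>_. borel"]
  have "indep_vars (\<lambda>_. borel) (\<lambda>i \<omega>. A \<omega> $ i) UNIV"
    by (simp add: borel_measurable_vec_lambda)
  then show ?thesis
    by (subst (asm) indep_vars_iff_distr_eq_PiM)
      (simp_all add: distr_gaussian_row random_variable_gaussian_row)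
qed

text \<open>Here the entries are grouped by columns: coordinate \<open>j\<close> of the sum uses
  column \<open>j\<close> only, so the coordinates are independent. Each is a sum of
  \<open>CARD('m)\<close> standard normals, and the scaling restores unit variance.\<close>

lemma distr_gaussian_sum_rows:
  "distr M borel (\<lambda>\<omega>. (1 / sqrt (real CARD('m))) *\<^sub>R (\<Sum>i\<in>UNIV. A \<omega> $ i)) = std_gaussian"
proof -
  let ?s = "1 / sqrt (real CARD('m))"
  let ?K = "\<lambda>j. (UNIV :: 'm set) \<times> {j}"
  have "indep_vars (\<lambda>j. PiM (?K j) (\<lambda>_. borel))
      (\<lambda>j \<omega>. restrict (\<lambda>k. (case k of (i, j) \<Rightarrow> \<lambda>\<omega>. A \<omega> $ i $ j) \<omega>) (?K j)) UNIV"
    by (intro indep_vars_restrict[OF ind]) (auto simp: disjoint_family_on_def)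
  from indep_vars_compose2[OF this, of "\<lambda>j y. ?s * (\<Sum>i\<in>UNIV. y (i, j))" "\<lambda>_. borel"]
  have ind': "indep_vars (\<lambda>_. borel) (\<lambda>j \<omega>. ?s * (\<Sum>i\<in>UNIV. A \<omega> $ i $ j)) UNIV"
    by simp
  have "distributed M lborel (\<lambda>\<omega>. ?s * (\<Sum>i\<in>UNIV. A \<omega> $ i $ j)) std_normal_density" for j
  proof -
    have "indep_vars (\<lambda>_. borel) (\<lambda>i \<omega>. A \<omega> $ i $ j) UNIV"
      using indep_vars_reindex_UNIV[OF ind, of "\<lambda>i. (i, j)"] by (simp add: inj_def)
    from sum_indep_normal[OF finite UNIV_not_empty this, of "\<lambda>_. 1" "\<lambda>_. 0"]
    have "distributed M lborel (\<lambda>\<omega>. \<Sum>i\<in>UNIV. A \<omega> $ i $ j) (normal_density 0 (sqrt (real CARD('m))))"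
      by (simp add: dist)
    from normal_density_affine[OF this, of ?s 0] show ?thesis
      by simp
  qed
  note distr_indep_std_normal[OF ind' this]
  also have "(\<lambda>\<omega>. \<chi> j. ?s * (\<Sum>i\<in>UNIV. A \<omega> $ i $ j)) = (\<lambda>\<omega>. ?s *\<^sub>R (\<Sum>i\<in>UNIV. A \<omega> $ i))"
    by (simp add: fun_eq_iff vec_eq_iff)
  finally show ?thesis .
qed

end

end

subsection \<open>Program solutions and mean width\<close>

lemma minkowski_functional_le_1:
  assumes "x \<in> K"
  shows "minkowski_functional K x \<le> 1"
  unfolding minkowski_functional_def by (rule INF_lower2[of 1]) (use assms in auto)

text \<open>The infimum need not be attained, so only the closure is reached. For every
  \<open>s n > 1\<close> some admissible \<open>l < s n\<close> exists, and star-shapedness shrinks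
  \<open>z / l\<close> by the factor \<open>l / s n\<close> to \<open>z / s n\<close>, which tends
  to \<open>z\<close>.\<close>

lemma mem_closure_of_minkowski_functional_le_1:
  fixes K :: "'a::real_normed_vector set"
  assumes "star_shaped K" "minkowski_functional K z \<le> 1"
  shows "z \<in> closure K"
proof -
  define s :: "nat \<Rightarrow> real" where "s n = 1 + 1 / Suc n" for n
  have s1: "s n > 1" for n
    by (simp add: s_def)
  have "inverse (s n) *\<^sub>R z \<in> K" for n
  proof -
    have "minkowski_functional K z < ereal (s n)"
      using assms(2) s1[of n] by (metis le_less_trans less_ereal.simps(1) one_ereal_def)
    then obtain l where l: "l > 0" "inverse l *\<^sub>R z \<in> K" "l < s n"
      unfolding minkowski_functional_def by (auto simp: INF_less_iff)
    have "\<forall>t\<in>{0..1}. \<forall>x\<in>K. t *\<^sub>R x \<in> K"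
      using assms(1) by (simp add: star_shaped_def image_subset_iff)
    moreover have "l / s n \<in> {0..1}"
      using l s1[of n] by simp
    ultimately have "(l / s n) *\<^sub>R (inverse l *\<^sub>R z) \<in> K"
      using l(2) by blast
    then show ?thesis
      using l by (simp add: field_simps)
  qed
  moreover have "s \<longlonglongrightarrow> 1 + 0"
    unfolding s_def by (intro tendsto_intros LIMSEQ_Suc[OF lim_1_over_n])
  then have "(\<lambda>n. inverse (s n) *\<^sub>R z) \<longlonglongrightarrow> inverse 1 *\<^sub>R z"
    by (intro tendsto_intros) auto
  ultimately show ?thesis
    unfolding closure_sequential by (auto intro!: exI[of _ "\<lambda>n. inverse (s n) *\<^sub>R z"])
qed

text \<open>The signal \<open>x\<close> is itself feasible with functional value at most 1, so a
  minimiser has value at most 1 as well.\<close>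

lemma is_program_solution_mem_closure:
  fixes A :: "real ^ 'n ^ 'm"
  assumes "star_shaped K" "x \<in> K" "norm1 (A *v x - y) / real CARD('m) \<le> \<epsilon>"
    and "is_program_solution K \<epsilon> A y z"
  shows "z \<in> closure K"
proof (rule mem_closure_of_minkowski_functional_le_1[OF assms(1)])
  have "\<not> minkowski_functional K x < minkowski_functional K z"
    using assms(3,4) by (auto simp: is_program_solution_def is_arg_min_def)
  then show "minkowski_functional K z \<le> 1"
    using minkowski_functional_le_1[OF assms(2)] by auto
qed

lemma norm1_triangle: "norm1 (a + b) \<le> norm1 a + norm1 b"
  unfolding norm1_def by (simp add: sum.distrib[symmetric] sum_mono)

lemma norm1_uminus: "norm1 (- a) = norm1 a"
  by (simp add: norm1_def)

section \<open>Dense subsets and the mean width\<close>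

text \<open>The half-space cut out by the supremum over \<open>D\<close> is closed and contains
  \<open>D\<close>, hence also \<open>closure D\<close> and \<open>T\<close>.\<close>

lemma cSUP_inner_dense:
  fixes D :: "'a::real_inner set"
  assumes "D \<noteq> {}" "D \<subseteq> T" "T \<subseteq> closure D" "bounded T"
  shows "(SUP u\<in>T. g \<bullet> u) = (SUP u\<in>D. g \<bullet> u)"
proof (rule antisym)
  have b: "bdd_above ((\<lambda>u. g \<bullet> u) ` T)" "bdd_above ((\<lambda>u. g \<bullet> u) ` D)"
    using bdd_above_inner[of _ 1 g] bounded_subset[OF assms(4,2)] assms(4) by auto
  have "closure D \<subseteq> {u. g \<bullet> u \<le> (SUP u\<in>D. g \<bullet> u)}"
    by (rule closure_minimal) (auto intro: cSUP_upper b closed_halfspace_le)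
  then show "(SUP u\<in>T. g \<bullet> u) \<le> (SUP u\<in>D. g \<bullet> u)"
    using assms by (intro cSUP_least) auto
  show "(SUP u\<in>D. g \<bullet> u) \<le> (SUP u\<in>T. g \<bullet> u)"
    using assms b by (intro cSUP_subset_mono) auto
qed

text \<open>The width is defined by a Bochner integral while the estimates use
  \<open>nn_integral\<close>. They agree because the supremum over \<open>D\<close> is measurable
  and lies between 0 and \<open>R * norm g\<close>.\<close>

lemma nn_integral_sup_inner_eq_mean_width:
  fixes K :: "(real ^ 'n) set"
  assumes "bounded K" "countable D" "0 \<in> D"
    and "D \<subseteq> {u - v | u v. u \<in> K \<and> v \<in> K}" "{u - v | u v. u \<in> K \<and> v \<in> K} \<subseteq> closure D"
  shows "0 \<le> gaussian_mean_width K"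
    and "(\<integral>\<^sup>+g. ennreal (SUP u\<in>D. g \<bullet> u) \<partial>std_gaussian) = ennreal (gaussian_mean_width K)"
proof -
  have bT: "bounded {u - v | u v. u \<in> K \<and> v \<in> K}"
    using bounded_minus[OF assms(1,1)] by (rule bounded_subset) blast
  have D: "bounded D"
    using bT assms(4) by (rule bounded_subset)
  have b: "bdd_above ((\<lambda>u. g \<bullet> u) ` D)" for g
    using bdd_above_inner[OF D, of 1 g] by simp
  obtain R where R: "\<And>u. u \<in> D \<Longrightarrow> norm u \<le> R"
    using D by (auto simp: bounded_iff)
  have nonneg: "0 \<le> (SUP u\<in>D. g \<bullet> u)" for g
    by (rule cSUP_nonneg[OF b assms(3)]) simp
  have le: "(SUP u\<in>D. g \<bullet> u) \<le> R * norm g" for g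
  proof (rule cSUP_least)
    fix u assume "u \<in> D"
    have "g \<bullet> u \<le> norm g * norm u"
      by (rule norm_cauchy_schwarz)
    also have "\<dots> \<le> norm g * R"
      using R[OF \<open>u \<in> D\<close>] by (intro mult_left_mono) auto
    finally show "g \<bullet> u \<le> R * norm g" by (simp add: mult.commute)
  qed (use assms in auto)
  have w: "gaussian_mean_width K = (\<integral>g. (SUP u\<in>D. g \<bullet> u) \<partial>std_gaussian)"
    unfolding gaussian_mean_width_def using assms(3)
    by (subst cSUP_inner_dense[OF _ assms(4,5) bT]) auto
  have "integrable (std_gaussian :: (real ^ 'n) measure) (\<lambda>g. SUP u\<in>D. g \<bullet> u)"
  proof (rule Bochner_Integration.integrable_bound)
    show "integrable (std_gaussian :: (real ^ 'n) measure) (\<lambda>g. R * norm g)"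
      by (intro integrable_mult_right integrable_norm_std_gaussian)
    show "(\<lambda>g. SUP u\<in>D. g \<bullet> u) \<in> borel_measurable (std_gaussian :: (real ^ 'n) measure)"
      by (rule borel_measurable_cSUP[OF assms(2) _ b]) simp
    show "AE g in (std_gaussian :: (real ^ 'n) measure). norm (SUP u\<in>D. g \<bullet> u) \<le> norm (R * norm g)"
    proof (rule AE_I2)
      show "norm (SUP u\<in>D. g \<bullet> u) \<le> norm (R * norm g)" for g
        using nonneg[of g] le[of g] by simp
    qed
  qed
  then show "(\<integral>\<^sup>+g. ennreal (SUP u\<in>D. g \<bullet> u) \<partial>std_gaussian) = ennreal (gaussian_mean_width K)"
    by (simp add: w nn_integral_eq_integral nonneg)
  show "0 \<le> gaussian_mean_width K"
    unfolding w by (rule Bochner_Integration.integral_nonneg[OF nonneg])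
qed

subsection \<open>The error bound\<close>

text \<open>Exchanging all rows, starting from the shift 0, leaves an expression linear in the rows,
  so only their sum matters. It is \<open>sqrt (real CARD('m))\<close> times the standard Gaussian
  vector \<open>S\<close>, which explains the factor on the right.\<close>

lemma (in prob_space) nn_integral_sup_gaussian_matrix:
  fixes A :: "'a \<Rightarrow> real ^ 'n ^ 'm"
  assumes ind: "indep_vars (\<lambda>_. borel) (\<lambda>(i, j) \<omega>. A \<omega> $ i $ j) (UNIV :: ('m \<times> 'n) set)"
    and dist: "\<And>i j. distributed M lborel (\<lambda>\<omega>. A \<omega> $ i $ j) std_normal_density"
    and D: "countable D" "bounded D" "0 \<in> D"
  shows "(\<lambda>\<omega>. SUP u\<in>D. \<Sum>i\<in>UNIV. sqrt (2 / pi) * norm u - \<bar>A \<omega> $ i \<bullet> u\<bar>) \<in> borel_measurable M"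
      (is ?measurable)
    and "(\<integral>\<^sup>+\<omega>. ennreal (SUP u\<in>D. \<Sum>i\<in>UNIV. sqrt (2 / pi) * norm u - \<bar>A \<omega> $ i \<bullet> u\<bar>) \<partial>M)
      \<le> ennreal (2 * sqrt (real CARD('m))) * (\<integral>\<^sup>+g. ennreal (SUP u\<in>D. g \<bullet> u) \<partial>std_gaussian)"
      (is ?bound)
proof -
  let ?c = "sqrt (2 / pi)" and ?s = "sqrt (real CARD('m))"
  let ?P = "\<Pi>\<^sub>M i\<in>(UNIV :: 'm set). (borel :: (real ^ 'n) measure)"
  let ?X = "\<lambda>\<omega>. \<lambda>i\<in>UNIV. A \<omega> $ i"
  define S where "S \<omega> = (1 / ?s) *\<^sub>R (\<Sum>i\<in>UNIV. A \<omega> $ i)" for \<omega>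
  have [measurable]: "(\<lambda>\<omega>. A \<omega> $ i) \<in> borel_measurable M" for i
    by (rule random_variable_gaussian_row[OF ind dist])
  have [measurable]: "S \<in> borel_measurable M"
    unfolding S_def by measurable
  have b: "bdd_above ((\<lambda>u. \<Sum>i\<in>UNIV. ?c * norm u - \<bar>x i \<bullet> u\<bar>) ` D)" for x :: "'m \<Rightarrow> real ^ 'n"
  proof (rule bdd_above_image_sum)
    show "bdd_above ((\<lambda>u. ?c * norm u - \<bar>x i \<bullet> u\<bar>) ` D)" for i
      using bdd_above_image_add[OF bdd_above_norm_mult[OF D(2), of ?c]
        bdd_above_abs_inner[OF D(2), of "-1" "x i"]] by simp
  qed
  have b': "bdd_above ((\<lambda>u. \<Sum>i\<in>UNIV. 2 * (x i \<bullet> u)) ` D)" for x :: "'m \<Rightarrow> real ^ 'n"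
    by (rule bdd_above_image_sum) (rule bdd_above_inner[OF D(2)])
  have bg: "bdd_above ((\<lambda>u. g \<bullet> u) ` D)" for g
    using bdd_above_inner[OF D(2), of 1 g] by simp
  show ?measurable
    by (rule borel_measurable_cSUP[OF D(1) _ b]) measurable
  have m1: "(\<lambda>x. ennreal (SUP u\<in>D. \<Sum>i\<in>UNIV. ?c * norm u - \<bar>x i \<bullet> u\<bar>)) \<in> borel_measurable ?P"
    by (intro measurable_compose[OF _ measurable_ennreal] borel_measurable_cSUP[OF D(1) _ b]) measurable
  have m2: "(\<lambda>x. ennreal (SUP u\<in>D. \<Sum>i\<in>UNIV. 2 * (x i \<bullet> u))) \<in> borel_measurable ?P"
    by (intro measurable_compose[OF _ measurable_ennreal] borel_measurable_cSUP[OF D(1) _ b']) measurable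
  have m3: "(\<lambda>g. ennreal (SUP u\<in>D. g \<bullet> u)) \<in> borel_measurable borel"
    by (intro measurable_compose[OF _ measurable_ennreal] borel_measurable_cSUP[OF D(1) _ bg]) measurable
  have X: "?X \<in> M \<rightarrow>\<^sub>M ?P"
    by measurable
  have "(\<integral>\<^sup>+\<omega>. ennreal (SUP u\<in>D. \<Sum>i\<in>UNIV. ?c * norm u - \<bar>A \<omega> $ i \<bullet> u\<bar>) \<partial>M) =
      (\<integral>\<^sup>+x. ennreal (SUP u\<in>D. \<Sum>i\<in>UNIV. ?c * norm u - \<bar>x i \<bullet> u\<bar>) \<partial>distr M ?P ?X)"
    by (subst nn_integral_distr[OF X]) (use m1 in simp_all)
  also have "\<dots> \<le> (\<integral>\<^sup>+x. ennreal (SUP u\<in>D. \<Sum>i\<in>UNIV. 2 * (x i \<bullet> u)) \<partial>distr M ?P ?X)"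
    unfolding distr_gaussian_rows[OF ind dist]
    using nn_integral_sup_gaussian_rows[of "UNIV :: 'm set" D "\<lambda>_. 0"] D
    by (simp add: bdd_aboveI2[where M = 0])
  also have "\<dots> = (\<integral>\<^sup>+\<omega>. ennreal (SUP u\<in>D. \<Sum>i\<in>UNIV. 2 * (A \<omega> $ i \<bullet> u)) \<partial>M)"
    by (subst nn_integral_distr[OF X]) (use m2 in simp_all)
  also have "\<dots> \<le> (\<integral>\<^sup>+\<omega>. ennreal (2 * ?s) * ennreal (SUP u\<in>D. S \<omega> \<bullet> u) \<partial>M)"
  proof (rule nn_integral_mono)
    fix \<omega>
    have "(SUP u\<in>D. \<Sum>i\<in>UNIV. 2 * (A \<omega> $ i \<bullet> u)) \<le> 2 * ?s * (SUP u\<in>D. S \<omega> \<bullet> u)"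
    proof (rule cSUP_least)
      fix u assume "u \<in> D"
      have "(\<Sum>i\<in>UNIV. 2 * (A \<omega> $ i \<bullet> u)) = 2 * ?s * (S \<omega> \<bullet> u)"
        by (simp add: S_def inner_sum_left sum_distrib_left)
      also have "\<dots> \<le> 2 * ?s * (SUP u\<in>D. S \<omega> \<bullet> u)"
        by (intro mult_left_mono cSUP_upper[OF \<open>u \<in> D\<close> bg]) simp
      finally show "(\<Sum>i\<in>UNIV. 2 * (A \<omega> $ i \<bullet> u)) \<le> 2 * ?s * (SUP u\<in>D. S \<omega> \<bullet> u)" .
    qed (use D in auto)
    then show "ennreal (SUP u\<in>D. \<Sum>i\<in>UNIV. 2 * (A \<omega> $ i \<bullet> u)) \<le> ennreal (2 * ?s) * ennreal (SUP u\<in>D. S \<omega> \<bullet> u)"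
      by (subst ennreal_mult'[symmetric]) (auto intro: ennreal_leI)
  qed
  also have "\<dots> = ennreal (2 * ?s) * (\<integral>\<^sup>+\<omega>. ennreal (SUP u\<in>D. S \<omega> \<bullet> u) \<partial>M)"
    by (intro nn_integral_cmult measurable_compose[OF _ m3]) measurable
  also have "(\<integral>\<^sup>+\<omega>. ennreal (SUP u\<in>D. S \<omega> \<bullet> u) \<partial>M) =
      (\<integral>\<^sup>+g. ennreal (SUP u\<in>D. g \<bullet> u) \<partial>distr M borel S)"
    by (rule nn_integral_distr[symmetric]) (auto intro: m3)
  also have "distr M borel S = std_gaussian"
    unfolding S_def by (rule distr_gaussian_sum_rows[OF ind dist])
  finally show ?bound .
qed

text \<open>The supremum bounds a continuous function on \<open>D\<close>, hence also on
  \<open>closure D\<close>. At \<open>z\<close> the sum over the rows is the left-hand side minus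
  \<open>norm1 (B *v z)\<close>.\<close>

lemma norm_le_sup_gaussian_matrix:
  fixes B :: "real ^ 'n ^ 'm"
  assumes "bounded D" "z \<in> closure D"
  shows "real CARD('m) * (sqrt (2 / pi) * norm z) \<le>
    (SUP u\<in>D. \<Sum>i\<in>UNIV. sqrt (2 / pi) * norm u - \<bar>B $ i \<bullet> u\<bar>) + norm1 (B *v z)"
proof -
  let ?f = "\<lambda>u. \<Sum>i\<in>UNIV. sqrt (2 / pi) * norm u - \<bar>B $ i \<bullet> u\<bar>"
  have b: "bdd_above (?f ` D)"
  proof (rule bdd_above_image_sum)
    show "bdd_above ((\<lambda>u. sqrt (2 / pi) * norm u - \<bar>B $ i \<bullet> u\<bar>) ` D)" for i
      using bdd_above_image_add[OF bdd_above_norm_mult[OF assms(1), of "sqrt (2 / pi)"]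
        bdd_above_abs_inner[OF assms(1), of "-1" "B $ i"]] by simp
  qed
  have "closure D \<subseteq> {u. ?f u \<le> (SUP u\<in>D. ?f u)}"
  proof (rule closure_minimal)
    show "closed {u. ?f u \<le> (SUP u\<in>D. ?f u)}"
      by (intro closed_Collect_le continuous_intros)
  qed (auto intro: cSUP_upper b)
  then have "?f z \<le> (SUP u\<in>D. ?f u)"
    using assms(2) by auto
  then show ?thesis
    by (simp add: sum_subtractf norm1_def matrix_mult_dot)
qed

text \<open>Triangle inequality through \<open>y\<close>: each of the two feasible points
  contributes one \<epsilon>.\<close>

lemma norm1_matrix_error_le:
  fixes B :: "real ^ 'n ^ 'm"
  assumes "norm1 (B *v z - y) / real CARD('m) \<le> \<epsilon>" "norm1 (B *v x - y) / real CARD('m) \<le> \<epsilon>"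
  shows "norm1 (B *v (z - x)) \<le> real CARD('m) * (2 * \<epsilon>)"
proof -
  have "norm1 (B *v (z - x)) = norm1 ((B *v z - y) + - (B *v x - y))"
    by (simp add: matrix_vector_mult_diff_distrib)
  also have "\<dots> \<le> norm1 (B *v z - y) + norm1 (B *v x - y)"
    using norm1_triangle[of "B *v z - y" "- (B *v x - y)"] by (simp only: norm1_uminus)
  also have "\<dots> \<le> real CARD('m) * \<epsilon> + real CARD('m) * \<epsilon>"
    using assms by (intro add_mono) (simp_all add: field_simps)
  finally show ?thesis by (simp add: mult_ac)
qed

theorem theorem6p2:
  fixes K :: "(real ^ 'n) set"
    and \<epsilon> :: real
    and M :: "'w measure"
    and A :: "'w \<Rightarrow> real ^ 'n ^ 'm"
    and \<nu> :: "'w \<Rightarrow> real ^ 'n \<Rightarrow> real ^ 'm"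
    and y :: "'w \<Rightarrow> real ^ 'n \<Rightarrow> real ^ 'm"
    and xhat :: "real ^ 'n ^ 'm \<Rightarrow> real ^ 'm \<Rightarrow> real ^ 'n"
  assumes "bounded K" and "star_shaped K" and "interior K \<noteq> {}"
    and "\<epsilon> \<ge> 0"
    and "prob_space M"
    and "prob_space.indep_vars M (\<lambda>_. borel) (\<lambda>(i, j) \<omega>. A \<omega> $ i $ j) (UNIV :: ('m \<times> 'n) set)"
    and "\<And>i j. distributed M lborel (\<lambda>\<omega>. A \<omega> $ i $ j) std_normal_density"
    and "\<And>\<omega> x. \<omega> \<in> space M \<Longrightarrow> x \<in> K \<Longrightarrow> norm1 (\<nu> \<omega> x) / real CARD('m) \<le> \<epsilon>"
    and "\<And>\<omega> x. \<omega> \<in> space M \<Longrightarrow> x \<in> K \<Longrightarrow> y \<omega> x = A \<omega> *v x + \<nu> \<omega> x"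
    and "\<And>\<omega> x. \<omega> \<in> space M \<Longrightarrow> x \<in> K \<Longrightarrow>
           is_program_solution K \<epsilon> (A \<omega>) (y \<omega> x) (xhat (A \<omega>) (y \<omega> x))"
  shows "upper_expectation M (\<lambda>\<omega>. SUP x\<in>K. ennreal (norm (xhat (A \<omega>) (y \<omega> x) - x)))
           \<le> ennreal (sqrt (8 * pi) * (gaussian_mean_width K / sqrt (real CARD('m)) + \<epsilon>))"
proof -
  interpret prob_space M by fact
  let ?c = "sqrt (2 / pi)" and ?m = "real CARD('m)"
  let ?T = "{u - v | u v. u \<in> K \<and> v \<in> K}"
  let ?Z = "\<lambda>B::real ^ 'n ^ 'm. \<lambda>D. SUP u\<in>D. \<Sum>i\<in>UNIV. ?c * norm u - \<bar>B $ i \<bullet> u\<bar>"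
  have c: "?c > 0" by simp
  obtain k where k: "k \<in> K"
    using assms(3) interior_subset by fast
  obtain D0 where D0: "countable D0" "D0 \<subseteq> ?T" "?T \<subseteq> closure D0"
    by (rule separable)
  \<comment> \<open>A countable dense set need not contain 0; adding it keeps \<open>D\<close>
    inside the difference set and makes the suprema nonnegative.\<close>
  define D where "D = insert 0 D0"
  have "\<exists>u v. (0 :: real ^ 'n) = u - v \<and> u \<in> K \<and> v \<in> K"
    using k by (intro exI[of _ k]) simp
  then have D: "countable D" "D \<subseteq> ?T" "0 \<in> D"
    using D0(1,2) by (auto simp: D_def)
  have dense: "?T \<subseteq> closure D"
    using D0(3) closure_mono[of D0 D] unfolding D_def by (meson subset_insertI subset_trans)
  have bT: "bounded ?T"
    using bounded_minus[OF assms(1,1)] by (rule bounded_subset) blast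
  have bD: "bounded D"
    using bT D(2) by (rule bounded_subset)
  note width = nn_integral_sup_inner_eq_mean_width[OF assms(1) D(1,3,2) dense]
  note meas = nn_integral_sup_gaussian_matrix(1)[OF assms(6,7) D(1) bD D(3)]
  note bound = nn_integral_sup_gaussian_matrix(2)[OF assms(6,7) D(1) bD D(3)]

  \<comment> \<open>The right-hand side does not depend on \<open>x\<close>, so one measurable
    function of \<omega> dominates the whole supremum, whatever the noise and the choice of
    minimiser.\<close>
  have pointwise: "norm (xhat (A \<omega>) (y \<omega> x) - x) \<le> inverse (?m * ?c) * ?Z (A \<omega>) D + 2 * \<epsilon> / ?c"
    if \<omega>: "\<omega> \<in> space M" and x: "x \<in> K" for \<omega> x
  proof -
    let ?z = "xhat (A \<omega>) (y \<omega> x)"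
    note sol = assms(10)[OF \<omega> x]
    have feas: "norm1 (A \<omega> *v x - y \<omega> x) / ?m \<le> \<epsilon>"
      using assms(8)[OF \<omega> x] by (simp add: assms(9)[OF \<omega> x] norm1_uminus)
    have "?z \<in> closure K"
      by (rule is_program_solution_mem_closure[OF assms(2) x feas sol])
    \<comment> \<open>Translation by \<open>- x\<close> is continuous, so a point of
      \<open>closure K\<close> goes to a limit of differences \<open>u - x\<close> with
      \<open>u \<in> K\<close>.\<close>
    moreover have "(\<lambda>u. u - x) ` closure K \<subseteq> closure ((\<lambda>u. u - x) ` K)"
      by (intro continuous_image_closure_subset[of UNIV] continuous_intros) auto
    moreover have "closure ((\<lambda>u. u - x) ` K) \<subseteq> closure D"
      using x dense by (intro closure_minimal) auto
    ultimately have "?z - x \<in> closure D"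
      by blast
    from norm_le_sup_gaussian_matrix[OF bD this, of "A \<omega>"]
    have "?m * (?c * norm (?z - x)) \<le> ?Z (A \<omega>) D + norm1 (A \<omega> *v (?z - x))" .
    also have "norm1 (A \<omega> *v (?z - x)) \<le> ?m * (2 * \<epsilon>)"
      using sol feas by (intro norm1_matrix_error_le)
        (auto simp: is_program_solution_def is_arg_min_def)
    finally show ?thesis
      using c by (simp add: field_simps)
  qed

  \<comment> \<open>The pointwise bound is a witness in the infimum that defines
    \<open>upper_expectation\<close>.\<close>
  have "upper_expectation M (\<lambda>\<omega>. SUP x\<in>K. ennreal (norm (xhat (A \<omega>) (y \<omega> x) - x)))
      \<le> (\<integral>\<^sup>+\<omega>. ennreal (inverse (?m * ?c)) * ennreal (?Z (A \<omega>) D) + ennreal (2 * \<epsilon> / ?c) \<partial>M)"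
    unfolding upper_expectation_def
  proof (rule INF_lower, safe intro!: SUP_least)
    show "(\<lambda>\<omega>. ennreal (inverse (?m * ?c)) * ennreal (?Z (A \<omega>) D) + ennreal (2 * \<epsilon> / ?c)) \<in> borel_measurable M"
      using meas by measurable
    fix \<omega> x assume "\<omega> \<in> space M" "x \<in> K"
    then have "ennreal (norm (xhat (A \<omega>) (y \<omega> x) - x))
        \<le> ennreal (inverse (?m * ?c) * ?Z (A \<omega>) D + 2 * \<epsilon> / ?c)"
      by (intro ennreal_leI pointwise)
    \<comment> \<open>Splitting is valid for either sign of the first term, since
      \<open>ennreal\<close> sends negative values to 0 and the second term is nonnegative.\<close>
    also have "\<dots> \<le> ennreal (inverse (?m * ?c) * ?Z (A \<omega>) D) + ennreal (2 * \<epsilon> / ?c)"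
      using assms(4) c by (cases "0 \<le> inverse (?m * ?c) * ?Z (A \<omega>) D") (auto intro!: ennreal_leI add_increasing)
    also have "\<dots> = ennreal (inverse (?m * ?c)) * ennreal (?Z (A \<omega>) D) + ennreal (2 * \<epsilon> / ?c)"
      by (subst ennreal_mult') auto
    finally show "ennreal (norm (xhat (A \<omega>) (y \<omega> x) - x))
        \<le> ennreal (inverse (?m * ?c)) * ennreal (?Z (A \<omega>) D) + ennreal (2 * \<epsilon> / ?c)" .
  qed
  also have "\<dots> = ennreal (inverse (?m * ?c)) * (\<integral>\<^sup>+\<omega>. ennreal (?Z (A \<omega>) D) \<partial>M) + ennreal (2 * \<epsilon> / ?c)"
    using meas by (subst nn_integral_add) (auto simp: nn_integral_cmult emeasure_space_1)
  also have "\<dots> \<le> ennreal (inverse (?m * ?c)) * (ennreal (2 * sqrt ?m) * ennreal (gaussian_mean_width K))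
      + ennreal (2 * \<epsilon> / ?c)"
    using bound unfolding width(2) by (intro add_right_mono mult_left_mono) auto
  also have "\<dots> = ennreal (inverse (?m * ?c) * (2 * sqrt ?m * gaussian_mean_width K) + 2 * \<epsilon> / ?c)"
    using width(1) assms(4) by (simp add: ennreal_mult')
  also have "inverse (?m * ?c) * (2 * sqrt ?m * gaussian_mean_width K) + 2 * \<epsilon> / ?c =
      2 / ?c * (gaussian_mean_width K / sqrt ?m + \<epsilon>)"
  proof -
    \<comment> \<open>Writing \<open>?m\<close> as a product of square roots lets one of them cancel
      against the numerator.\<close>
    have "inverse (sqrt ?m * sqrt ?m * ?c) * (2 * sqrt ?m * gaussian_mean_width K) =
        2 / ?c * (gaussian_mean_width K / sqrt ?m)"
      using c by (simp add: divide_simps del: real_sqrt_mult_self)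
    then show ?thesis
      by (simp add: distrib_left)
  qed
  also have "ennreal \<dots> \<le> ennreal (sqrt (8 * pi) * (gaussian_mean_width K / sqrt ?m + \<epsilon>))"
  proof (intro ennreal_leI mult_right_mono)
    \<comment> \<open>The argument yields \<open>sqrt (2 * pi)\<close>, half of the claimed constant
      \<open>sqrt (8 * pi)\<close>.\<close>
    have "2 / ?c = sqrt (2 * pi)"
      by (simp add: real_sqrt_divide real_sqrt_mult field_simps)
    then show "2 / ?c \<le> sqrt (8 * pi)"
      by simp
  qed (use width(1) assms(4) in simp)
  finally show ?thesis .
qed

end
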